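(* Let $n\ge2$, $0\le\alpha\le1$, and let $\mathrm{Ham}(3,n)=K_n\square K_n\square K_n$ be the cubic lattice graph of characteristic $n$. Then the generalized distance spectrum of $\mathrm{Ham}(3,n)$ consists of: (1) $3n^{2}(n-1)$; (2) $(\alpha-1)n^{2}+3\alpha n^{2}(n-1)$, with multiplicity $3(n-1)$; (3) $3\alpha n^{2}(n-1)$, with multiplicity $n^{3}-3n+2$.
   Context: $\mathrm{Ham}(3,n)$ has as vertices all $3$-tuples over an $n$-element set, two tuples adjacent iff they differ in exactly one coordinate; equivalently the Cartesian product of three copies of $K_n$ (in $G\square H$, $(u_1,v_1)\sim(u_2,v_2)$ iff $u_1=u_2$ and $v_1v_2\in E(H)$, or $v_1=v_2$ and $u_1u_2\in E(G)$). The generalized distance matrix is $\mathcal{D}_\alpha=\alpha\,Tr+(1-\alpha)\mathcal{D}$, where $\mathcal{D}$ is the distance matrix and $Tr$ the diagonal matrix of vertex transmissions $Tr(u)=\sum_v d(u,v)$; its multiset of eigenvalues is the generalized distance spectrum. *)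

theory Defs
  imports
    "Graph_Theory.Kuratowski"
    "Graph_Theory.Shortest_Path"
    "Jordan_Normal_Form.Char_Poly"
begin

section \<open>Cartesian products and cubic lattice graphs\<close>

definition cartesian_product ::
    "'a pair_pre_digraph \<Rightarrow> 'b pair_pre_digraph \<Rightarrow> ('a \<times> 'b) pair_pre_digraph"
    (infixr \<open>\<box>\<close> 75) where
  "G \<box> H = \<lparr> pverts = pverts G \<times> pverts H,
     parcs = {((u1, v1), (u2, v2)) | u1 v1 u2 v2.
       (u1 = u2 \<and> u1 \<in> pverts G \<and> (v1, v2) \<in> parcs H) \<or>
       (v1 = v2 \<and> v1 \<in> pverts H \<and> (u1, u2) \<in> parcs G)} \<rparr>"

text \<open>For a complete graph \<open>K\<close> on \<open>n\<close> vertices, this is \<open>Ham(3, n)\<close> over the \<open>n\<close>-element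
  set \<open>pverts K\<close>.\<close>
definition hamming3 :: "'a pair_pre_digraph \<Rightarrow> ('a \<times> 'a \<times> 'a) pair_pre_digraph" where
  "hamming3 K = K \<box> K \<box> K"

lemma pair_graph_cartesian_product:
  assumes "pair_graph G" and "pair_graph H"
  shows "pair_graph (G \<box> H)"
proof -
  interpret G: pair_graph G by fact
  interpret H: pair_graph H by fact
  have sub: "parcs (G \<box> H) \<subseteq> (pverts G \<times> pverts H) \<times> (pverts G \<times> pverts H)"
    using G.wellformed' H.wellformed' by (auto simp: cartesian_product_def)
  have fin: "finite (pverts (G \<box> H))"
    by (simp add: cartesian_product_def)
  have "finite (parcs (G \<box> H))"
    by (rule finite_subset[OF sub]) simp
  moreover have "sym (parcs (G \<box> H))"
    using G.sym_arcs H.sym_arcs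
    by (auto simp: cartesian_product_def symmetric_def sym_def)
  ultimately show ?thesis
    using fin sub G.no_loops H.no_loops
    by unfold_locales
      (auto simp: cartesian_product_def symmetric_def dest: G.wellformed' H.wellformed')
qed

text \<open>Two triples are adjacent iff they differ in exactly one coordinate.\<close>
lemma hamming3_adjacent_iff:
  assumes "K\<^bsub>n\<^esub> (with_proj K)"
  shows "((x1, x2, x3), (y1, y2, y3)) \<in> parcs (hamming3 K) \<longleftrightarrow>
    {x1, x2, x3, y1, y2, y3} \<subseteq> pverts K \<and>
    card {i :: nat. i < 3 \<and> [x1, x2, x3] ! i \<noteq> [y1, y2, y3] ! i} = 1"
proof -
  have "{i :: nat. i < 3 \<and> [x1, x2, x3] ! i \<noteq> [y1, y2, y3] ! i} =
      (if x1 \<noteq> y1 then {0} else {}) \<union> (if x2 \<noteq> y2 then {1} else {}) \<union>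
      (if x3 \<noteq> y3 then {2} else {})"
    by (auto simp: less_Suc_eq numeral_3_eq_3 numeral_2_eq_2)
  then show ?thesis
    using assms
    by (auto simp: hamming3_def cartesian_product_def complete_digraph_pair_def)
qed

section \<open>The generalized distance matrix\<close>

text \<open>Length of a shortest walk; the conversion to \<open>real\<close> loses information only if \<open>v\<close> is not
  reachable from \<open>u\<close>, where the library gives \<open>\<infinity>\<close>.\<close>
definition graph_dist :: "'a pair_pre_digraph \<Rightarrow> 'a \<Rightarrow> 'a \<Rightarrow> real" where
  "graph_dist G u v = real_of_ereal (wf_digraph.\<mu> (with_proj G) (\<lambda>_. 1) u v)"

definition transmission :: "'a pair_pre_digraph \<Rightarrow> 'a \<Rightarrow> real" where
  "transmission G u = (\<Sum>v\<in>pverts G. graph_dist G u v)"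

text \<open>In the matrices below, \<open>vs\<close> lists the vertices of \<open>G\<close> without repetition; row and column
  \<open>i\<close> belong to the vertex \<open>vs ! i\<close>.\<close>

definition distance_matrix :: "'a pair_pre_digraph \<Rightarrow> 'a list \<Rightarrow> real mat" where
  "distance_matrix G vs =
     mat (length vs) (length vs) (\<lambda>(i, j). graph_dist G (vs ! i) (vs ! j))"

definition transmission_matrix :: "'a pair_pre_digraph \<Rightarrow> 'a list \<Rightarrow> real mat" where
  "transmission_matrix G vs = mat_diag (length vs) (\<lambda>i. transmission G (vs ! i))"

definition gen_distance_matrix :: "real \<Rightarrow> 'a pair_pre_digraph \<Rightarrow> 'a list \<Rightarrow> real mat" where
  "gen_distance_matrix \<alpha> G vs =
     \<alpha> \<cdot>\<^sub>m transmission_matrix G vs + (1 - \<alpha>) \<cdot>\<^sub>m distance_matrix G vs"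

text \<open>The eigenvalues with their algebraic multiplicities. Counting only real roots is harmless,
  since the matrix is symmetric for an undirected graph.\<close>
definition gen_distance_spectrum ::
    "real \<Rightarrow> 'a pair_pre_digraph \<Rightarrow> 'a list \<Rightarrow> real multiset" where
  "gen_distance_spectrum \<alpha> G vs = proots (char_poly (gen_distance_matrix \<alpha> G vs))"

end

theory Submission
  imports Defs "Jordan_Normal_Form.Schur_Decomposition"
begin

text \<open>The distance in \<open>Ham(3, n)\<close> is the Hamming distance, so the distance matrix \<open>D\<close> has constant
  row sums \<open>t = 3n\<^sup>2(n - 1)\<close> and satisfies \<open>D\<^sup>2 + n\<^sup>2 D = cJ\<close>, where \<open>J\<close> is the all-ones matrix and
  \<open>c = 3n(n - 1)(3n - 2)\<close>. An eigenvector whose entries sum to \<open>0\<close> is killed by \<open>J\<close>, any other one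
  belongs to \<open>t\<close>; hence every complex eigenvalue of \<open>D\<close> is \<open>0\<close>, \<open>-n\<^sup>2\<close> or \<open>t\<close>. The traces \<open>0\<close>
  of \<open>D\<close> and \<open>n\<^sup>3 c\<close> of \<open>D\<^sup>2\<close> then determine the multiplicities. Since all transmissions equal \<open>t\<close>,
  the generalized distance matrix is \<open>\<alpha> t I + (1 - \<alpha>) D\<close>.\<close>

section \<open>Traces, similarity and the roots of the characteristic polynomial\<close>

lemma sum_list_diag_mat:
  fixes A :: "'a :: semiring_1 mat"
  assumes "A \<in> carrier_mat n n"
  shows "sum_list (diag_mat A) = (\<Sum>i<n. A $$ (i, i))"
  using assms by (simp add: diag_mat_def sum_list_sum_nth atLeast0LessThan)

lemma sum_list_diag_mat_mult_commute:
  fixes A B :: "'a :: comm_semiring_1 mat"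
  assumes A: "A \<in> carrier_mat n m" and B: "B \<in> carrier_mat m n"
  shows "sum_list (diag_mat (A * B)) = sum_list (diag_mat (B * A))"
proof -
  have "sum_list (diag_mat (A * B)) = (\<Sum>i<n. \<Sum>k<m. A $$ (i, k) * B $$ (k, i))"
    using A B by (subst sum_list_diag_mat[of _ n]) (auto simp: scalar_prod_def atLeast0LessThan)
  also have "\<dots> = (\<Sum>k<m. \<Sum>i<n. B $$ (k, i) * A $$ (i, k))"
    by (subst sum.swap) (simp add: mult.commute)
  also have "\<dots> = sum_list (diag_mat (B * A))"
    using A B by (subst sum_list_diag_mat[of _ m]) (auto simp: scalar_prod_def atLeast0LessThan)
  finally show ?thesis .
qed

lemma sum_list_diag_mat_similar:
  fixes A B :: "'a :: comm_ring_1 mat"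
  assumes "similar_mat A B"
  shows "sum_list (diag_mat A) = sum_list (diag_mat B)"
proof -
  obtain n P Q where c: "A \<in> carrier_mat n n" "B \<in> carrier_mat n n" "P \<in> carrier_mat n n"
      "Q \<in> carrier_mat n n" and QP: "Q * P = 1\<^sub>m n" and A: "A = P * B * Q"
    using similar_matD[OF assms] by auto
  have "sum_list (diag_mat A) = sum_list (diag_mat (Q * (P * B)))"
    unfolding A using c by (intro sum_list_diag_mat_mult_commute) auto
  also have "Q * (P * B) = B"
    using c QP by (simp flip: assoc_mult_mat[of Q n n P n B n])
  finally show ?thesis .
qed

lemma similar_mat_square:
  fixes A B :: "'a :: comm_ring_1 mat"
  assumes "similar_mat A B"
  shows "similar_mat (A * A) (B * B)"
proof -
  obtain n P Q where c: "A \<in> carrier_mat n n" "B \<in> carrier_mat n n" "P \<in> carrier_mat n n"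
      "Q \<in> carrier_mat n n" and PQ: "P * Q = 1\<^sub>m n" "Q * P = 1\<^sub>m n" and A: "A = P * B * Q"
    using similar_matD[OF assms] by auto
  have "A * A = P * B * (Q * P) * B * Q"
    unfolding A using c by (simp add: assoc_mult_mat[where n\<^sub>2=n and n\<^sub>3=n and n\<^sub>4=n])
  also have "\<dots> = P * (B * B) * Q"
    using c PQ by (simp add: assoc_mult_mat[where n\<^sub>2=n and n\<^sub>3=n and n\<^sub>4=n])
  finally show ?thesis
    using c PQ by (intro similar_matI[of _ _ P Q n]) auto
qed

text \<open>Conjugation fixes scalar matrices, so the pair \<open>P\<close>, \<open>Q\<close> that
  takes \<open>B\<close> to \<open>A\<close> also serves the affine images. This carries a
  triangular form of the distance matrix over to the generalized distance matrix.\<close>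

lemma similar_mat_affine:
  fixes A B :: "'a :: comm_ring_1 mat"
  assumes "similar_mat A B" and A: "A \<in> carrier_mat n n"
  shows "similar_mat (a \<cdot>\<^sub>m 1\<^sub>m n + b \<cdot>\<^sub>m A) (a \<cdot>\<^sub>m 1\<^sub>m n + b \<cdot>\<^sub>m B)"
proof -
  obtain P Q where wit: "similar_mat_wit A B P Q"
    using assms(1) unfolding similar_mat_def by blast
  note c = similar_mat_witD2(4-)[OF A wit] and PQ = similar_mat_witD2(1,2)[OF A wit]
    and A_eq = similar_mat_witD2(3)[OF A wit]
  have "P * (a \<cdot>\<^sub>m 1\<^sub>m n + b \<cdot>\<^sub>m B) = a \<cdot>\<^sub>m P + b \<cdot>\<^sub>m (P * B)"
    using c by (subst mult_add_distrib_mat[of _ n n _ n]) (auto simp: mult_smult_distrib[of _ n n _ n])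
  then have "P * (a \<cdot>\<^sub>m 1\<^sub>m n + b \<cdot>\<^sub>m B) * Q = a \<cdot>\<^sub>m (P * Q) + b \<cdot>\<^sub>m (P * B * Q)"
    using c by (simp only:, subst add_mult_distrib_mat[of _ n n _ _ n])
      (auto simp: mult_smult_assoc_mat[of _ n n _ n])
  with PQ(1) A_eq have "a \<cdot>\<^sub>m 1\<^sub>m n + b \<cdot>\<^sub>m A = P * (a \<cdot>\<^sub>m 1\<^sub>m n + b \<cdot>\<^sub>m B) * Q"
    by simp
  then show ?thesis
    using c PQ by (intro similar_matI[of _ _ P Q n]) auto
qed

text \<open>For k different from i, one of the positions (i, k) and (k, i) lies strictly below the
  diagonal. Only the term k = i survives in the i-th diagonal entry of \<open>B * B\<close>.\<close>

lemma diag_mat_square_upper_triangular: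
  fixes B :: "'a :: comm_ring_1 mat"
  assumes B: "B \<in> carrier_mat n n" and ut: "upper_triangular B"
  shows "diag_mat (B * B) = map (\<lambda>e. e\<^sup>2) (diag_mat B)"
proof (rule nth_equalityI)
  fix i assume "i < length (diag_mat (B * B))"
  then have i: "i < n" using B by (simp add: diag_mat_def)
  have "(\<Sum>k<n. B $$ (i, k) * B $$ (k, i)) = (\<Sum>k\<in>{i}. B $$ (i, k) * B $$ (k, i))"
  proof (rule sum.mono_neutral_right)
    show "\<forall>k\<in>{..<n} - {i}. B $$ (i, k) * B $$ (k, i) = 0"
    proof
      fix k assume "k \<in> {..<n} - {i}"
      then have "k < i \<or> i < k" "k < n" by auto
      then show "B $$ (i, k) * B $$ (k, i) = 0"
        using ut B i by (auto simp: upper_triangular_def)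
    qed
  qed (use i in auto)
  then show "diag_mat (B * B) ! i = map (\<lambda>e. e\<^sup>2) (diag_mat B) ! i"
    using B i by (simp add: diag_mat_def scalar_prod_def atLeast0LessThan power2_eq_square)
qed (use B in \<open>simp add: diag_mat_def\<close>)

text \<open>A Schur decomposition makes \<open>A\<close> similar to an upper triangular
  \<open>B\<close> with diagonal \<open>es\<close>. All three claims are then read off a diagonal:
  that of \<open>B\<close>, of \<open>B * B\<close>, and of the affine image of
  \<open>B\<close>.\<close>

lemma
  fixes A :: "'a :: conjugatable_ordered_field mat"
  assumes A: "A \<in> carrier_mat n n" and es: "char_poly A = (\<Prod>e\<leftarrow>es. [:- e, 1:])"
  shows sum_list_roots_char_poly: "sum_list es = sum_list (diag_mat A)"
    and sum_list_squared_roots_char_poly: "(\<Sum>e\<leftarrow>es. e\<^sup>2) = sum_list (diag_mat (A * A))"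
    and char_poly_affine:
      "char_poly (a \<cdot>\<^sub>m 1\<^sub>m n + b \<cdot>\<^sub>m A) = (\<Prod>e\<leftarrow>es. [:- (a + b * e), 1:])"
proof -
  obtain B P Q where "schur_decomposition A es = (B, P, Q)"
    by (metis prod.exhaust)
  from schur_decomposition[OF A es this]
  have wit: "similar_mat_wit A B P Q" and ut: "upper_triangular B" and diag: "diag_mat B = es"
    by auto
  from wit have sim: "similar_mat A B"
    unfolding similar_mat_def by blast
  have B: "B \<in> carrier_mat n n"
    using similar_mat_witD2[OF A wit] by simp
  show "sum_list es = sum_list (diag_mat A)"
    using sum_list_diag_mat_similar[OF sim] diag by simp
  show "(\<Sum>e\<leftarrow>es. e\<^sup>2) = sum_list (diag_mat (A * A))"
    using sum_list_diag_mat_similar[OF similar_mat_square[OF sim]]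
      diag_mat_square_upper_triangular[OF B ut] diag by simp
  let ?C = "a \<cdot>\<^sub>m 1\<^sub>m n + b \<cdot>\<^sub>m B"
  have C: "?C \<in> carrier_mat n n" "upper_triangular ?C"
    using B ut by (auto simp: upper_triangular_def)
  have "diag_mat ?C = map (\<lambda>e. a + b * e) es"
    unfolding diag[symmetric] using B by (auto simp: diag_mat_def)
  then show "char_poly (a \<cdot>\<^sub>m 1\<^sub>m n + b \<cdot>\<^sub>m A) = (\<Prod>e\<leftarrow>es. [:- (a + b * e), 1:])"
    using char_poly_similar[OF similar_mat_affine[OF sim A, of a b]] char_poly_upper_triangular[OF C]
    by (simp add: o_def)
qed

text \<open>The Schur argument over the reals requires a characteristic polynomial that splits
  there. It always splits over the complex numbers; when all its roots are real, the factorization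
  descends along the injective embedding of real polynomials.\<close>

lemma char_poly_real_linear_factors:
  fixes A :: "real mat"
  assumes A: "A \<in> carrier_mat n n"
    and real: "\<And>z. eigenvalue (map_mat complex_of_real A) z \<Longrightarrow> z \<in> \<real>"
  obtains es where "char_poly A = (\<Prod>e\<leftarrow>es. [:- e, 1:])" "length es = n"
proof -
  have A': "map_mat complex_of_real A \<in> carrier_mat n n"
    using A by simp
  obtain zs where zs: "char_poly (map_mat complex_of_real A) = (\<Prod>z\<leftarrow>zs. [:- z, 1:])"
      and len: "length zs = n"
    using char_poly_factorized[OF A'] by blast
  have "z \<in> \<real>" if "z \<in> set zs" for z
    using that real zs A' eigenvalue_root_char_poly[OF A', of z]
    by (auto simp: poly_prod_list prod_list_zero_iff)
  then have "map (complex_of_real \<circ> Re) zs = zs"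
    by (auto intro: map_idI)
  then obtain es where es: "zs = map complex_of_real es"
    by (metis map_map)
  interpret of_real_poly: map_poly_inj_comm_ring_hom complex_of_real ..
  have "map_poly complex_of_real (char_poly A) = map_poly complex_of_real (\<Prod>e\<leftarrow>es. [:- e, 1:])"
    using zs unfolding es of_real_hom.char_poly_hom[OF A]
    by (simp add: of_real_poly.hom_prod_list o_def)
  then have "char_poly A = (\<Prod>e\<leftarrow>es. [:- e, 1:])"
    by (rule of_real_poly.injectivity)
  with that len es show ?thesis
    by simp
qed

text \<open>The hypothesis \<open>sq\<close> says A^2 + qA = cJ with J the all-ones matrix. Any
  field is allowed because the lemma serves twice: over the complex numbers to see that the
  eigenvalues are real, and over the reals to locate the roots.\<close>

lemma eigenvalue_square_add_smult_const:
  fixes A :: "'a :: field mat"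
  assumes A: "A \<in> carrier_mat n n" and ev: "eigenvalue A z"
    and col: "\<And>j. j < n \<Longrightarrow> (\<Sum>i<n. A $$ (i, j)) = t"
    and sq: "\<And>i j. i < n \<Longrightarrow> j < n \<Longrightarrow> (\<Sum>k<n. A $$ (i, k) * A $$ (k, j)) = c - q * A $$ (i, j)"
  shows "z \<in> {0, - q, t}"
proof -
  obtain v where v: "v \<in> carrier_vec n" "v \<noteq> 0\<^sub>v n" and Av: "A *\<^sub>v v = z \<cdot>\<^sub>v v"
    using ev A unfolding eigenvalue_def eigenvector_def by auto
  have row: "(\<Sum>j<n. A $$ (i, j) * v $ j) = z * v $ i" if "i < n" for i
    using arg_cong[OF Av, of "\<lambda>w. w $ i"] A v that
    by (simp add: mult_mat_vec_def scalar_prod_def atLeast0LessThan)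
  let ?s = "\<Sum>i<n. v $ i"
  \<comment> \<open>Left multiplication of Av = zv by the all-ones row vector turns the column sums
    into the factor \<open>t\<close>.\<close>
  have "z * ?s = (\<Sum>i<n. \<Sum>j<n. A $$ (i, j) * v $ j)"
    by (simp add: row sum_distrib_left)
  also have "\<dots> = (\<Sum>j<n. (\<Sum>i<n. A $$ (i, j)) * v $ j)"
    by (subst sum.swap) (simp add: sum_distrib_right)
  finally have sum: "z * ?s = t * ?s"
    by (simp add: col sum_distrib_left)
  obtain i where i: "i < n" "v $ i \<noteq> 0"
    using v by (metis eq_vecI carrier_vecD index_zero_vec)
  \<comment> \<open>Entry \<open>i\<close> of A(Av) is computed in two ways: as z^2 v, and through
    the formula for A^2.\<close>
  have "z * (z * v $ i) = (\<Sum>k<n. A $$ (i, k) * (\<Sum>j<n. A $$ (k, j) * v $ j))"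
  proof -
    have "(\<Sum>k<n. A $$ (i, k) * (\<Sum>j<n. A $$ (k, j) * v $ j)) = (\<Sum>k<n. z * (A $$ (i, k) * v $ k))"
      by (rule sum.cong) (simp_all add: row mult.left_commute)
    also have "\<dots> = z * (z * v $ i)"
      using row[OF i(1)] by (simp flip: sum_distrib_left)
    finally show ?thesis ..
  qed
  also have "\<dots> = (\<Sum>j<n. (\<Sum>k<n. A $$ (i, k) * A $$ (k, j)) * v $ j)"
    unfolding sum_distrib_left sum_distrib_right by (subst sum.swap) (simp add: mult.assoc)
  also have "\<dots> = (\<Sum>j<n. c * v $ j - q * (A $$ (i, j) * v $ j))"
    using i by (intro sum.cong) (simp_all add: sq left_diff_distrib mult.assoc)
  also have "\<dots> = c * ?s - q * (z * v $ i)"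
    using i by (simp add: sum_subtractf row flip: sum_distrib_left)
  finally have main: "z * (z * v $ i) = c * ?s - q * (z * v $ i)" .
  show ?thesis
  proof (cases "?s = 0")
    case True
    with main have "(z * (z + q)) * v $ i = 0"
      by (simp add: algebra_simps)
    with i show ?thesis
      by (auto simp: add_eq_0_iff2)
  next
    case False
    with sum show ?thesis by simp
  qed
qed


section \<open>Distances in Ham(3, n) and their sums over triples\<close>

definition hamming_dist3 :: "'a \<times> 'a \<times> 'a \<Rightarrow> 'a \<times> 'a \<times> 'a \<Rightarrow> nat" where
  "hamming_dist3 = (\<lambda>(x1, x2, x3) (y1, y2, y3).
     of_bool (x1 \<noteq> y1) + of_bool (x2 \<noteq> y2) + of_bool (x3 \<noteq> y3))"

lemma pverts_hamming3: "pverts (hamming3 K) = pverts K \<times> pverts K \<times> pverts K"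
  by (simp add: hamming3_def cartesian_product_def)

lemma parcs_hamming3:
  assumes "K\<^bsub>n\<^esub> (with_proj K)"
  shows "(u, v) \<in> parcs (hamming3 K) \<longleftrightarrow>
    u \<in> pverts (hamming3 K) \<and> v \<in> pverts (hamming3 K) \<and> hamming_dist3 u v = 1"
  using assms
  by (cases u; cases v)
    (auto simp: hamming3_def cartesian_product_def complete_digraph_pair_def hamming_dist3_def)

lemma hamming_dist3_triangle: "hamming_dist3 u w \<le> hamming_dist3 u v + hamming_dist3 v w"
  by (cases u; cases v; cases w) (auto simp: hamming_dist3_def)

text \<open>One arc lowers the Hamming distance to the target by at most 1, so no walk is shorter
  than that distance. Replacing the coordinates of \<open>u\<close> by those of \<open>v\<close> one
  at a time gives a walk of exactly that length.\<close>

lemma graph_dist_hamming3: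
  assumes K: "K\<^bsub>n\<^esub> (with_proj K)"
    and u: "u \<in> pverts (hamming3 K)" and v: "v \<in> pverts (hamming3 K)"
  shows "graph_dist (hamming3 K) u v = real (hamming_dist3 u v)"
proof -
  have "pair_graph K"
    using K by (rule pair_graphI_complete)
  then have "pair_graph (hamming3 K)"
    unfolding hamming3_def by (intro pair_graph_cartesian_product)
  then interpret pair_graph "hamming3 K" .
  have len: "awalk_cost (\<lambda>_. 1) p = real (length p)"
    for p :: "(('a \<times> 'a \<times> 'a) \<times> 'a \<times> 'a \<times> 'a) list"
    by (simp add: awalk_cost_def sum_list_triv)
  have lower: "hamming_dist3 x y \<le> length p" if "awalk x p y" for x y p
    using that
  proof (induction p arbitrary: x)
    case Nil
    then show ?case
      by (auto simp: awalk_Nil_iff hamming_dist3_def split: prod.split)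
  next
    case (Cons e p)
    then have "e \<in> parcs (hamming3 K)" "x = fst e" "awalk (snd e) p y"
      by (simp_all add: awalk_Cons_iff)
    with Cons.IH[of "snd e"] parcs_hamming3[OF K, of "fst e" "snd e"]
    show ?case
      using hamming_dist3_triangle[of x y "snd e"] by simp
  qed
  obtain x1 x2 x3 y1 y2 y3 where uv: "u = (x1, x2, x3)" "v = (y1, y2, y3)"
    by (metis prod.exhaust)
  \<comment> \<open>Distance 0 is included, with the empty walk, so that coordinates in which
    \<open>u\<close> and \<open>v\<close> already agree need no separate treatment.\<close>
  have step: "\<exists>p. awalk x p y \<and> length p = hamming_dist3 x y"
    if "x \<in> pverts (hamming3 K)" "y \<in> pverts (hamming3 K)" "hamming_dist3 x y \<le> 1" for x y
  proof (cases "hamming_dist3 x y = 0")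
    case True
    then have "x = y"
      by (cases x; cases y) (auto simp: hamming_dist3_def split: if_splits)
    with that True show ?thesis
      by (intro exI[of _ "[]"]) (simp add: awalk_Nil_iff)
  next
    case False
    with that have "(x, y) \<in> parcs (hamming3 K)" "hamming_dist3 x y = 1"
      by (simp_all add: parcs_hamming3[OF K])
    with that show ?thesis
      by (intro exI[of _ "[(x, y)]"]) (simp add: awalk_simps)
  qed
  \<comment> \<open>The vertices reached after one and after two replacements; the three successive
    distances add up to that from \<open>u\<close> to \<open>v\<close>.\<close>
  let ?w = "(y1, x2, x3)" and ?z = "(y1, y2, x3)"
  have mem: "?w \<in> pverts (hamming3 K)" "?z \<in> pverts (hamming3 K)"
    using u v by (auto simp: uv pverts_hamming3)
  have le: "hamming_dist3 u ?w \<le> 1" "hamming_dist3 ?w ?z \<le> 1" "hamming_dist3 ?z v \<le> 1"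
    by (simp_all add: uv hamming_dist3_def of_bool_def)
  obtain p where p: "awalk u p ?w" "length p = hamming_dist3 u ?w"
    using step[OF u mem(1) le(1)] by blast
  obtain q where q: "awalk ?w q ?z" "length q = hamming_dist3 ?w ?z"
    using step[OF mem le(2)] by blast
  obtain r where r: "awalk ?z r v" "length r = hamming_dist3 ?z v"
    using step[OF mem(2) v le(3)] by blast
  have "length (p @ q @ r) = hamming_dist3 u v"
    by (simp add: p q r uv hamming_dist3_def)
  then obtain s where s: "awalk u s v" "length s = hamming_dist3 u v"
    using p q r by (blast intro: awalk_appendI)
  have "\<mu> (\<lambda>_. 1) u v = ereal (real (hamming_dist3 u v))"
    unfolding \<mu>_def
  proof (rule INF_eqI)
    fix b assume "\<And>p. p \<in> {p. awalk u p v} \<Longrightarrow> b \<le> ereal (awalk_cost (\<lambda>_. 1) p)"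
    from this[of s] s show "b \<le> ereal (real (hamming_dist3 u v))"
      by (simp add: len)
  qed (use lower in \<open>simp add: len\<close>)
  then show ?thesis
    by (simp add: graph_dist_def)
qed

text \<open>Each inequality indicator is 1 minus an equality indicator, and sums of the latter pick
  out single elements. In matrix form the second identity is (J - I)^2 = (n - 1)J - (J - I), with n
  the size of \<open>V\<close>.\<close>

lemma
  assumes "finite V" and "x \<in> V"
  shows sum_of_bool_neq: "(\<Sum>y\<in>V. of_bool (x \<noteq> y) :: real) = real (card V) - 1"
    and sum_of_bool_neq_mult: "z \<in> V \<Longrightarrow>
      (\<Sum>y\<in>V. of_bool (x \<noteq> y) * of_bool (y \<noteq> z) :: real) = real (card V) - 1 - of_bool (x \<noteq> z)"
proof -
  have neq: "of_bool (a \<noteq> b) = (1 - of_bool (a = b) :: real)" for a b :: 'a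
    by simp
  have delta: "(\<Sum>y\<in>V. of_bool (x = y) :: real) = 1"
    "z \<in> V \<Longrightarrow> (\<Sum>y\<in>V. of_bool (y = z) :: real) = 1"
    using assms by (simp_all add: of_bool_def)
  have "(\<Sum>y\<in>V. of_bool (x = y) * of_bool (y = z) :: real) =
      (\<Sum>y\<in>V. if x = y then of_bool (x = z) else 0)"
    by (intro sum.cong) auto
  then have delta2: "(\<Sum>y\<in>V. of_bool (x = y) * of_bool (y = z) :: real) = of_bool (x = z)"
    using assms by simp
  show "(\<Sum>y\<in>V. of_bool (x \<noteq> y) :: real) = real (card V) - 1"
    unfolding neq using delta by (simp add: sum_subtractf)
  show "(\<Sum>y\<in>V. of_bool (x \<noteq> y) * of_bool (y \<noteq> z) :: real) = real (card V) - 1 - of_bool (x \<noteq> z)"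
    if "z \<in> V"
    unfolding neq using delta delta2 that by (simp add: sum_subtractf sum.distrib algebra_simps)
qed

lemma sum_triples:
  "(\<Sum>v\<in>V \<times> V \<times> V. f v) = (\<Sum>a\<in>V. \<Sum>b\<in>V. \<Sum>c\<in>V. f (a, b, c))"
  by (simp add: sum.cartesian_product)

text \<open>The distance is a sum of one indicator per coordinate, so the sums factor over the
  coordinates. In the second one, the three products of indicators in the same coordinate contribute
  3n^2(n - 1) - n^2 d(u, w). The six products in different coordinates contribute n(n - 1)^2 each.
  The constants combine to 3n(n - 1)(3n - 2).\<close>

lemma
  assumes V: "finite V" "card V = n" and u: "u \<in> V \<times> V \<times> V"
  shows sum_hamming_dist3:
      "(\<Sum>v\<in>V \<times> V \<times> V. real (hamming_dist3 u v)) = 3 * (real n)\<^sup>2 * (real n - 1)"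
    and sum_hamming_dist3_mult: "w \<in> V \<times> V \<times> V \<Longrightarrow>
      (\<Sum>v\<in>V \<times> V \<times> V. real (hamming_dist3 u v) * real (hamming_dist3 v w)) =
      3 * real n * (real n - 1) * (3 * real n - 2) - (real n)\<^sup>2 * real (hamming_dist3 u w)"
proof -
  define d :: "'a \<Rightarrow> 'a \<Rightarrow> real" where "d x y = of_bool (x \<noteq> y)" for x y
  have dist: "real (hamming_dist3 (x1, x2, x3) (y1, y2, y3)) = d x1 y1 + d x2 y2 + d x3 y3"
    for x1 x2 x3 y1 y2 y3
    by (simp add: hamming_dist3_def d_def)
  have sum: "(\<Sum>y\<in>V. d x y) = real n - 1" "(\<Sum>y\<in>V. d y x) = real n - 1" if "x \<in> V" for x
    using sum_of_bool_neq[OF V(1) that] V(2) unfolding d_def by (simp_all only: eq_commute)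
  have sum_mult: "(\<Sum>y\<in>V. d x y * d y z) = real n - 1 - d x z" if "x \<in> V" "z \<in> V" for x z
    using sum_of_bool_neq_mult[OF V(1) that] V(2) unfolding d_def by simp
  obtain x1 x2 x3 where x: "u = (x1, x2, x3)" "x1 \<in> V" "x2 \<in> V" "x3 \<in> V"
    using u by auto
  show "(\<Sum>v\<in>V \<times> V \<times> V. real (hamming_dist3 u v)) = 3 * (real n)\<^sup>2 * (real n - 1)"
    unfolding sum_triples x(1) dist using x V
    by (simp add: sum.distrib sum flip: sum_distrib_left)
      (simp add: power2_eq_square algebra_simps)
  assume "w \<in> V \<times> V \<times> V"
  then obtain z1 z2 z3 where z: "w = (z1, z2, z3)" "z1 \<in> V" "z2 \<in> V" "z3 \<in> V"
    by auto
  show "(\<Sum>v\<in>V \<times> V \<times> V. real (hamming_dist3 u v) * real (hamming_dist3 v w)) =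
      3 * real n * (real n - 1) * (3 * real n - 2) - (real n)\<^sup>2 * real (hamming_dist3 u w)"
    unfolding sum_triples x(1) z(1) dist using x z V
    by (simp add: sum.distrib distrib_left distrib_right sum sum_mult
        flip: sum_distrib_left sum_distrib_right)
      (simp add: power2_eq_square algebra_simps)
qed

section \<open>From power sums of the roots to the spectrum\<close>

lemma mset_two_nonzero_values:
  fixes es :: "'a :: comm_semiring_1 list"
  assumes "set es \<subseteq> {0, x, y}" and "x \<noteq> y" "x \<noteq> 0" "y \<noteq> 0"
  obtains k l m where "mset es = replicate_mset k x + replicate_mset l y + replicate_mset m 0"
    "length es = k + l + m" "sum_list es = of_nat k * x + of_nat l * y"
    "(\<Sum>e\<leftarrow>es. e\<^sup>2) = of_nat k * x\<^sup>2 + of_nat l * y\<^sup>2"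
proof -
  define k l m where "k = count (mset es) x" and "l = count (mset es) y" and "m = count (mset es) 0"
  \<comment> \<open>The three values are pairwise distinct, so no entry is counted twice. Zeros drop
    out of both power sums, which leaves two equations for \<open>k\<close> and
    \<open>l\<close>.\<close>
  have mset: "mset es = replicate_mset k x + replicate_mset l y + replicate_mset m 0"
  proof (rule multiset_eqI)
    fix e
    show "count (mset es) e = count (replicate_mset k x + replicate_mset l y + replicate_mset m 0) e"
      using assms by (cases "e \<in> set es") (auto simp: k_def l_def m_def count_mset_0_iff)
  qed
  show thesis
  proof
    show "length es = k + l + m"
      by (simp add: mset flip: size_mset)
    show "sum_list es = of_nat k * x + of_nat l * y"
      by (simp add: mset flip: sum_mset_sum_list)
    have "(\<Sum>e\<leftarrow>es. e\<^sup>2) = (\<Sum>e\<in>#mset es. e\<^sup>2)"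
      by (simp flip: sum_mset_sum_list)
    then show "(\<Sum>e\<leftarrow>es. e\<^sup>2) = of_nat k * x\<^sup>2 + of_nat l * y\<^sup>2"
      by (simp add: mset)
  qed (fact mset)
qed

lemma proots_linear_factors: "proots (\<Prod>e\<leftarrow>es. [:- f e, 1:]) = image_mset f (mset es)"
proof (induction es)
  case (Cons e es)
  have "(\<Prod>e\<leftarrow>es. [:- f e, 1:]) \<noteq> 0"
    by (auto simp: prod_list_zero_iff)
  with Cons show ?case
    by (simp add: proots_mult del: mult_pCons_left)
qed simp

lemma sum_nth_distinct:
  "distinct xs \<Longrightarrow> (\<Sum>i<length xs. f (xs ! i)) = (\<Sum>x\<in>set xs. f x)"
  by (rule sum.reindex_bij_betw) (simp add: bij_betw_nth)

theorem theorem5p2: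
  fixes n :: nat and \<alpha> :: real and K :: "'a pair_pre_digraph" and vs :: "('a \<times> 'a \<times> 'a) list"
  assumes "n \<ge> 2" and "0 \<le> \<alpha>" and "\<alpha> \<le> 1"
    and "K\<^bsub>n\<^esub> (with_proj K)"
    and "distinct vs" and "set vs = pverts (hamming3 K)"
  shows "gen_distance_spectrum \<alpha> (hamming3 K) vs =
    {# 3 * (real n)^2 * (real n - 1) #}
    + replicate_mset (3 * (n - 1))
        ((\<alpha> - 1) * (real n)^2 + 3 * \<alpha> * (real n)^2 * (real n - 1))
    + replicate_mset (n^3 - 3 * n + 2) (3 * \<alpha> * (real n)^2 * (real n - 1))"
proof -
  let ?V = "pverts K" and ?H = "hamming3 K"
  define N where "N = n ^ 3"
  define D where "D = distance_matrix ?H vs"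
  define t where "t = 3 * (real n)\<^sup>2 * (real n - 1)"
  define q where "q = (real n)\<^sup>2"
  define c where "c = 3 * real n * (real n - 1) * (3 * real n - 2)"
  have V: "finite ?V" "card ?V = n"
    using assms(4) by (simp_all add: complete_digraph_pair_def)
  have vs: "set vs = ?V \<times> ?V \<times> ?V"
    using assms(6) by (simp add: pverts_hamming3)
  have len: "length vs = N"
    using distinct_card[OF assms(5)] V
    by (simp add: vs card_cartesian_product N_def power3_eq_cube)
  have mem: "vs ! i \<in> ?V \<times> ?V \<times> ?V" if "i < N" for i
    using nth_mem[of i vs] that by (simp add: len vs)
  have sum_vs: "(\<Sum>i<N. f (vs ! i)) = (\<Sum>v\<in>?V \<times> ?V \<times> ?V. f v)"
    for f :: "'a \<times> 'a \<times> 'a \<Rightarrow> real"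
    using sum_nth_distinct[OF assms(5), of f] by (simp add: len vs)
  have dist: "graph_dist ?H u v = real (hamming_dist3 u v)"
    if "u \<in> ?V \<times> ?V \<times> ?V" "v \<in> ?V \<times> ?V \<times> ?V" for u v
    using graph_dist_hamming3[OF assms(4), of u v] that by (simp add: pverts_hamming3)
  have sym: "hamming_dist3 u v = hamming_dist3 v u" for u v :: "'a \<times> 'a \<times> 'a"
    by (cases u; cases v) (auto simp: hamming_dist3_def)
  have D: "D \<in> carrier_mat N N"
    by (simp add: D_def distance_matrix_def len)
  have entry: "D $$ (i, j) = real (hamming_dist3 (vs ! i) (vs ! j))" if "i < N" "j < N" for i j
    using that by (simp add: D_def distance_matrix_def len dist mem)
  have diag: "D $$ (i, i) = 0" if "i < N" for i
    using that by (simp add: entry hamming_dist3_def split: prod.split)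
  have col: "(\<Sum>i<N. D $$ (i, j)) = t" if "j < N" for j
    using sum_vs[of "\<lambda>v. real (hamming_dist3 (vs ! j) v)"] sum_hamming_dist3[OF V mem[OF that]] that
    by (simp add: entry t_def sym[of _ "vs ! j"])
  have sq: "(\<Sum>k<N. D $$ (i, k) * D $$ (k, j)) = c - q * D $$ (i, j)" if "i < N" "j < N" for i j
    using sum_vs[of "\<lambda>v. real (hamming_dist3 (vs ! i) v) * real (hamming_dist3 v (vs ! j))"]
      sum_hamming_dist3_mult[OF V mem[OF that(1)] mem[OF that(2)]] that
    by (simp add: entry c_def q_def)
  \<comment> \<open>This complex pass is used only to obtain that the eigenvalues are real, hence
    that the characteristic polynomial of \<open>D\<close> splits over the reals.\<close>
  have "z \<in> {0, - complex_of_real q, complex_of_real t}"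
    if "eigenvalue (map_mat complex_of_real D) z" for z
  proof (rule eigenvalue_square_add_smult_const[OF _ that])
    show "(\<Sum>i<N. map_mat complex_of_real D $$ (i, j)) = complex_of_real t" if "j < N" for j
      using col[OF that] D that by (simp flip: of_real_sum)
    show "(\<Sum>k<N. map_mat complex_of_real D $$ (i, k) * map_mat complex_of_real D $$ (k, j)) =
        complex_of_real c - complex_of_real q * map_mat complex_of_real D $$ (i, j)"
      if "i < N" "j < N" for i j
      using sq[OF that] D that by (simp flip: of_real_sum of_real_mult of_real_diff)
  qed (use D in simp)
  then have "z \<in> \<real>" if "eigenvalue (map_mat complex_of_real D) z" for z
    using that by fastforce
  from char_poly_real_linear_factors[OF D this]
  obtain es where es: "char_poly D = (\<Prod>e\<leftarrow>es. [:- e, 1:])" and len_es: "length es = N"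
    by blast
  have roots: "set es \<subseteq> {0, t, - q}"
  proof
    fix e assume "e \<in> set es"
    then have "eigenvalue D e"
      by (auto simp: eigenvalue_root_char_poly[OF D] es poly_prod_list prod_list_zero_iff)
    from eigenvalue_square_add_smult_const[OF D this col sq] show "e \<in> {0, t, - q}"
      by auto
  qed
  have pos: "t > 0" "q > 0"
    using assms(1) by (simp_all add: t_def q_def)
  have trace: "sum_list es = 0"
    using sum_list_roots_char_poly[OF D es] D by (simp add: sum_list_diag_mat diag)
  have "sum_list (diag_mat (D * D)) = (\<Sum>i<N. \<Sum>k<N. D $$ (i, k) * D $$ (k, i))"
    using D by (subst sum_list_diag_mat[of _ N]) (auto simp: scalar_prod_def atLeast0LessThan)
  \<comment> \<open>The diagonal of \<open>D\<close> vanishes, so by \<open>sq\<close> every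
    diagonal entry of \<open>D * D\<close> equals \<open>c\<close>.\<close>
  then have trace2: "(\<Sum>e\<leftarrow>es. e\<^sup>2) = N * c"
    using sum_list_squared_roots_char_poly[OF D es] by (simp add: sq diag)
  \<comment> \<open>The values \<open>t\<close> and \<open>- q\<close> have opposite signs, so they
    are distinct and nonzero.\<close>
  obtain k l m where mset: "mset es = replicate_mset k t + replicate_mset l (- q) + replicate_mset m 0"
      and klm: "length es = k + l + m" "sum_list es = of_nat k * t + of_nat l * - q"
        "(\<Sum>e\<leftarrow>es. e\<^sup>2) = of_nat k * t\<^sup>2 + of_nat l * (- q)\<^sup>2"
    using pos by (elim mset_two_nonzero_values[OF roots, rotated -1]) simp_all
  have kl: "real k * t = real l * q"
    using klm(2) trace by simp
  \<comment> \<open>The trace equation \<open>kl\<close> eliminates \<open>l\<close> from the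
    equation for the squares. Since t + q = n^2(3n - 2), the product t(t + q) equals n^3 c, which
    forces k = 1; then l = t/q.\<close>
  have "real k * (t * (t + q)) = real k * t\<^sup>2 + (real k * t) * q"
    by (simp add: power2_eq_square algebra_simps)
  also have "\<dots> = N * c"
    unfolding kl using klm(3) trace2 by (simp add: power2_eq_square mult.assoc)
  also have "\<dots> = t * (t + q)"
    by (simp add: N_def c_def t_def q_def power2_eq_square power3_eq_cube algebra_simps)
  finally have k: "k = 1"
    using pos by simp
  have "real l = 3 * (real n - 1)"
    using kl pos by (simp add: k t_def q_def)
  then have l: "l = 3 * (n - 1)"
    using assms(1) by (simp add: of_nat_diff flip: of_nat_eq_iff[where 'a = real])
  \<comment> \<open>The multiplicity in the goal uses truncated subtraction on the naturals; this
    bound makes it exact.\<close>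
  have "3 * n \<le> n ^ 3"
    using mult_le_mono1[OF mult_le_mono[OF assms(1) assms(1)], of n] by (auto simp: power3_eq_cube)
  moreover have "n ^ 3 = 1 + 3 * (n - 1) + m"
    using klm(1) by (simp add: len_es N_def k l)
  ultimately have m: "m = n ^ 3 - 3 * n + 2"
    using assms(1) by linarith
  have "transmission ?H v = t" if "v \<in> ?V \<times> ?V \<times> ?V" for v
    using that sum_hamming_dist3[OF V that] by (simp add: transmission_def pverts_hamming3 dist t_def)
  then have "gen_distance_matrix \<alpha> ?H vs = (\<alpha> * t) \<cdot>\<^sub>m 1\<^sub>m N + (1 - \<alpha>) \<cdot>\<^sub>m D"
    using D by (intro eq_matI)
      (auto simp: gen_distance_matrix_def transmission_matrix_def mat_diag_def D_def[symmetric] len mem)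
  \<comment> \<open>The map on eigenvalues is not injective when \<alpha> = 1, where every
    eigenvalue goes to \<open>t\<close>; the image multiset merges the multiplicities correctly in
    that case too.\<close>
  then have "gen_distance_spectrum \<alpha> ?H vs = image_mset (\<lambda>e. \<alpha> * t + (1 - \<alpha>) * e) (mset es)"
    by (simp add: gen_distance_spectrum_def char_poly_affine[OF D es] proots_linear_factors
        del: minus_add_distrib)
  also have "\<dots> = {# \<alpha> * t + (1 - \<alpha>) * t #}
    + replicate_mset (3 * (n - 1)) (\<alpha> * t + (1 - \<alpha>) * - q)
    + replicate_mset (n^3 - 3 * n + 2) (\<alpha> * t + (1 - \<alpha>) * 0)"
    by (simp add: mset k l m)
  also have "\<alpha> * t + (1 - \<alpha>) * t = 3 * (real n)^2 * (real n - 1)"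
    by (simp add: t_def algebra_simps)
  also have "\<alpha> * t + (1 - \<alpha>) * - q = (\<alpha> - 1) * (real n)^2 + 3 * \<alpha> * (real n)^2 * (real n - 1)"
    by (simp add: t_def q_def algebra_simps)
  also have "\<alpha> * t + (1 - \<alpha>) * 0 = 3 * \<alpha> * (real n)^2 * (real n - 1)"
    by (simp add: t_def)
  finally show ?thesis .
qed

end
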